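(* Let $\rho\in(0,1)$. The unit circle admits a non-trivial infinitesimal deformation as a smooth closed plane bicycle curve of perimeter $2\pi$ and rotation number $\rho$ if and only if $$n\tan(\pi\rho)=\tan(n\pi\rho)$$ for some integer $n\geq 2$.
   Context: A closed smooth plane curve $\Gamma$ of perimeter $2\pi$, parameterized by arc length as $\Gamma:\mathbf{R}/2\pi\mathbf{Z}\to\mathbf{R}^2$, is a bicycle curve with rotation number $\rho$ if, with $\omega=\pi\rho$, the chord length $|\Gamma(x+\omega)-\Gamma(x-\omega)|$ does not depend on $x$. Let $\Gamma_0(x)=(\cos x,\sin x)$. An infinitesimal deformation of the unit circle as a bicycle curve of perimeter $2\pi$ and rotation number $\rho$ is a smooth $2\pi$-periodic vector field $v:\mathbf{R}/2\pi\mathbf{Z}\to\mathbf{R}^2$ such that $\Gamma(x)=\Gamma_0(x)+\varepsilon v(x)$ satisfies, modulo $\varepsilon^2$: (i) $\Gamma$ is parameterized by arc length, i.e. $\Gamma_0'(x)\cdot v'(x)=0$ for all $x$; (ii) for some constant $c\in\mathbf{R}$, $|\Gamma(x+\omega)-\Gamma(x-\omega)|=2(\sin\omega+\varepsilon c)$ for all $x$, where $\omega=\pi\rho$. The deformation is trivial if $v$ is induced by an infinitesimal isometry of the plane (a combination of infinitesimal translations and an infinitesimal rotation), and non-trivial otherwise. The equation $n\tan(\pi\rho)=\tan(n\pi\rho)$ is understood as $n\cos(n\pi\rho)\sin(\pi\rho)=\cos(\pi\rho)\sin(n\pi\rho)$ (so that it holds if both tangents are infinite). *)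

theory Defs
  imports "HOL-Analysis.Analysis" "HOL-Library.Landau_Symbols"
begin

definition smooth :: "(real \<Rightarrow> real ^ 2) \<Rightarrow> bool" where
  "smooth v \<longleftrightarrow>
     (\<forall>k x. ((\<lambda>g t. vector_derivative g (at t)) ^^ k) v differentiable (at x))"

definition unit_circle :: "real \<Rightarrow> real ^ 2" where
  "unit_circle x = vector [cos x, sin x]"

definition perturbed_circle :: "(real \<Rightarrow> real ^ 2) \<Rightarrow> real \<Rightarrow> real \<Rightarrow> real ^ 2" where
  "perturbed_circle v \<epsilon> x = unit_circle x + \<epsilon> *\<^sub>R v x"

(* Functions on R / 2 pi Z are represented as 2 pi-periodic functions on the reals.
   Modulo \<epsilon>^2, the curve \<Gamma> = perturbed_circle v \<epsilon> has to be parameterized by arc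
   length, i.e. the first-order term 2 \<Gamma>0' \<bullet> v' of |\<Gamma>'|^2 vanishes, and has to have
   constant chord length; there "modulo \<epsilon>^2" is read as: up to O(\<epsilon>^2) as \<epsilon> \<rightarrow> 0. *)
definition infinitesimal_bicycle_deformation :: "real \<Rightarrow> (real \<Rightarrow> real ^ 2) \<Rightarrow> bool" where
  "infinitesimal_bicycle_deformation \<rho> v \<longleftrightarrow>
     smooth v \<and>
     (\<forall>x. v (x + 2 * pi) = v x) \<and>
     (\<forall>x. vector_derivative unit_circle (at x) \<bullet> vector_derivative v (at x) = 0) \<and>
     (let \<omega> = pi * \<rho> in
       \<exists>c. \<forall>x. (\<lambda>\<epsilon>. norm (perturbed_circle v \<epsilon> (x + \<omega>) - perturbed_circle v \<epsilon> (x - \<omega>))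
                      - 2 * (sin \<omega> + \<epsilon> * c)) \<in> O[at 0](\<lambda>\<epsilon>. \<epsilon>\<^sup>2))"

definition infinitesimal_isometry :: "(real ^ 2 \<Rightarrow> real ^ 2) \<Rightarrow> bool" where
  "infinitesimal_isometry X \<longleftrightarrow>
     (\<exists>a \<theta>. \<forall>p. X p = a + \<theta> *\<^sub>R vector [- (p $ 2), p $ 1])"

definition trivial_deformation :: "(real \<Rightarrow> real ^ 2) \<Rightarrow> bool" where
  "trivial_deformation v \<longleftrightarrow>
     (\<exists>X. infinitesimal_isometry X \<and> (\<forall>x. v x = X (unit_circle x)))"

end

(*
  Write v = a e_r + b e_t in the moving frame e_r = (cos x, sin x), e_t = (-sin x, cos x).
  Arc length means a = - b', and the first-order variation of the chord length turns condition (ii)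
  into sin w (b'(x + w) + b'(x - w)) - cos w (b(x + w) - b(x - w)) = const, with w = pi \<rho>.
  On Fourier coefficients (n \<noteq> 0) this reads
  (n cos(n w) sin w - cos w sin(n w)) B(n) = 0. The factor vanishes for n = 1, -1, whose modes
  together with n = 0 are exactly the infinitesimal isometries; so a non-trivial deformation exists
  iff it vanishes for some n \<ge> 2, the witness being b = cos(n x). That b is determined by its
  Fourier coefficients is obtained from the Stone-Weierstrass theorem on the circle.
*)
theory Submission
  imports Defs "HOL-Library.Periodic_Fun"
begin

subsection \<open>Fourier coefficients of periodic functions\<close>

text \<open>Subtract floor(x / (2 pi)) full periods from x. The free t lets the result serve for
  translated functions and, at t = 0, for single values.\<close>

lemma periodic_reduce:
  fixes f :: "real \<Rightarrow> 'a" and x :: real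
  assumes per: "\<And>x. f (x + 2 * pi) = f x"
  obtains s where "0 \<le> s" "s < 2 * pi" "\<And>t. f (t + x) = f (t + s)"
proof -
  interpret periodic_fun_simple f "2 * pi"
    by unfold_locales (rule per)
  define k where "k = \<lfloor>x / (2 * pi)\<rfloor>"
  have "of_int k \<le> x / (2 * pi)" "x / (2 * pi) < of_int k + 1"
    unfolding k_def by linarith+
  then have "0 \<le> x - of_int k * (2 * pi)" "x - of_int k * (2 * pi) < 2 * pi"
    by (auto simp: field_simps)
  moreover have "f (t + x) = f (t + (x - of_int k * (2 * pi)))" for t
    using minus_of_int[of "t + x" k] by (simp add: algebra_simps)
  ultimately show thesis
    by (rule that)
qed

text \<open>After reducing the shift to r in [0, 2 pi), the part of the window beyond 2 pi is moved
  back by one period to [0, r], where it fills the gap.\<close>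

lemma integral_periodic_shift:
  fixes h :: "real \<Rightarrow> complex"
  assumes cont: "continuous_on UNIV h" and per: "\<And>x. h (x + 2 * pi) = h x"
  shows "integral {0..2*pi} (\<lambda>x. h (x + s)) = integral {0..2*pi} h"
proof -
  have int: "h integrable_on {a..b}" for a b
    by (rule integrable_continuous_real) (rule continuous_on_subset[OF cont subset_UNIV])
  obtain r where r: "0 \<le> r" "r < 2 * pi" "\<And>t. h (t + s) = h (t + r)"
    using periodic_reduce[of h s] per by blast
  have "integral {0..2*pi} (\<lambda>x. h (x + s)) = integral {r..2*pi + r} h"
    using integral_shift_Icc_real[of 0 "2 * pi" h r] r(3) by (simp add: o_def add.commute)
  also have "\<dots> = integral {r..2*pi} h + integral {2*pi..2*pi + r} h"
    by (rule Henstock_Kurzweil_Integration.integral_combine[symmetric]) (use r int in auto)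
  also have "integral {2*pi..2*pi + r} h = integral {0..r} (\<lambda>x. h (x + 2 * pi))"
    using integral_shift_Icc_real[of 0 r h "2 * pi"] by (simp add: o_def add.commute)
  also have "\<dots> = integral {0..r} h"
    by (simp add: per)
  also have "integral {r..2*pi} h + integral {0..r} h = integral {0..2*pi} h"
    using Henstock_Kurzweil_Integration.integral_combine[of 0 r "2 * pi" h] r int by (simp add: add.commute)
  finally show ?thesis .
qed

text \<open>Unnormalised, and with kernel \<open>cis (n * x)\<close> instead of its conjugate: index
  n detects the frequency -n.\<close>

definition fourier_coeff :: "(real \<Rightarrow> complex) \<Rightarrow> int \<Rightarrow> complex" where
  "fourier_coeff f n = integral {0..2*pi} (\<lambda>x. f x * cis (of_int n * x))"

lemma fourier_coeff_integrable:
  assumes "continuous_on UNIV f"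
  shows "(\<lambda>x. f x * cis (of_int n * x)) integrable_on {a..b}"
  by (intro integrable_continuous_real continuous_intros continuous_on_subset[OF assms]) auto

lemma fourier_coeff_add:
  assumes "continuous_on UNIV f" "continuous_on UNIV g"
  shows "fourier_coeff (\<lambda>x. f x + g x) n = fourier_coeff f n + fourier_coeff g n"
  unfolding fourier_coeff_def
  by (simp add: distrib_right integral_add fourier_coeff_integrable assms)

lemma fourier_coeff_cmult: "fourier_coeff (\<lambda>x. k * f x) n = k * fourier_coeff f n"
  unfolding fourier_coeff_def by (simp add: mult.assoc)

lemma fourier_coeff_diff:
  assumes "continuous_on UNIV f" "continuous_on UNIV g"
  shows "fourier_coeff (\<lambda>x. f x - g x) n = fourier_coeff f n - fourier_coeff g n"
  unfolding fourier_coeff_def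
  by (simp add: left_diff_distrib integral_diff fourier_coeff_integrable assms)

lemma fourier_coeff_mult_cis:
  "fourier_coeff (\<lambda>x. f x * cis (of_int m * x)) n = fourier_coeff f (m + n)"
  unfolding fourier_coeff_def by (simp add: mult.assoc cis_mult distrib_right)

lemma fourier_coeff_cnj: "fourier_coeff (\<lambda>x. cnj (f x)) n = cnj (fourier_coeff f (- n))"
  unfolding fourier_coeff_def integral_cnj by (simp add: cis_cnj)

lemma cis_of_int_mult_2pi: "cis (of_int n * (2 * pi)) = 1"
  using cis_multiple_2pi[of "of_int n"] by (simp add: mult_ac)

lemma has_vector_derivative_cis_mult:
  "((\<lambda>x. cis (k * x)) has_vector_derivative \<i> * of_real k * cis (k * x)) (at x within S)"
  unfolding has_vector_derivative_def
  by (auto intro!: derivative_eq_intros simp: scaleR_conv_of_real)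

text \<open>Integration by parts; the boundary terms cancel because f and \<open>cis (n * x)\<close>
  both have period 2 pi.\<close>

lemma fourier_coeff_deriv:
  assumes der: "\<And>x. (f has_vector_derivative f' x) (at x)"
    and cont: "continuous_on UNIV f'" and per: "\<And>x. f (x + 2 * pi) = f x"
  shows "fourier_coeff f' n = - (\<i> * of_int n * fourier_coeff f n)"
proof -
  have contf: "continuous_on UNIV f"
    by (meson continuous_at_imp_continuous_on der has_vector_derivative_continuous)
  have "((\<lambda>x. f' x * cis (of_int n * x) + f x * (\<i> * of_int n * cis (of_int n * x)))
      has_integral f (2 * pi) * cis (of_int n * (2 * pi)) - f 0 * cis (of_int n * 0)) {0..2*pi}"
    using has_vector_derivative_cis_mult[of "of_int n"]
    by (intro fundamental_theorem_of_calculus)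
      (auto intro!: derivative_eq_intros has_vector_derivative_at_within[OF der])
  moreover have "f (2 * pi) = f 0"
    using per[of 0] by simp
  ultimately have "integral {0..2*pi} (\<lambda>x. f' x * cis (of_int n * x)
      + \<i> * of_int n * (f x * cis (of_int n * x))) = 0"
    by (intro integral_unique) (simp only: cis_of_int_mult_2pi, simp add: algebra_simps)
  then have "fourier_coeff f' n + \<i> * of_int n * fourier_coeff f n = 0"
    unfolding fourier_coeff_def using fourier_coeff_integrable[OF contf, of n 0 "2*pi"]
    by (subst (asm) integral_add)
      (auto intro: fourier_coeff_integrable cont contf integrable_on_mult_right)
  then show ?thesis
    by (simp add: eq_neg_iff_add_eq_0)
qed

lemma fourier_coeff_shift:
  assumes cont: "continuous_on UNIV f" and per: "\<And>x. f (x + 2 * pi) = f x"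
  shows "fourier_coeff (\<lambda>x. f (x + s)) n = cis (- of_int n * s) * fourier_coeff f n"
proof -
  define h where "h = (\<lambda>x. f x * cis (of_int n * x))"
  have "cis (of_int n * (x + 2 * pi)) = cis (of_int n * x)" for x
    using cis_of_int_mult_2pi[of n] by (simp add: distrib_left flip: cis_mult)
  then have "integral {0..2*pi} (\<lambda>x. h (x + s)) = integral {0..2*pi} h"
    by (intro integral_periodic_shift)
      (auto simp: h_def per intro!: continuous_intros cont)
  moreover have "f (x + s) * cis (of_int n * x) = cis (- of_int n * s) * h (x + s)" for x
    by (simp add: h_def cis_mult algebra_simps)
  ultimately show ?thesis
    unfolding fourier_coeff_def by (simp only: integral_mult_right h_def)
qed

text \<open>Orthogonality, read off from \<open>fourier_coeff_deriv\<close>: differentiating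
  \<open>cis (m * x)\<close> multiplies it by \<i> m, so \<i> (m + n) annihilates the
  coefficient.\<close>

lemma fourier_coeff_cis:
  "fourier_coeff (\<lambda>x. cis (of_int m * x)) n = (if m + n = 0 then 2 * pi else 0)"
proof -
  have "fourier_coeff (\<lambda>x. \<i> * of_real (of_int m) * cis (of_int m * x)) n
      = - (\<i> * of_int n * fourier_coeff (\<lambda>x. cis (of_int m * x)) n)"
    using cis_of_int_mult_2pi[of m]
    by (intro fourier_coeff_deriv has_vector_derivative_cis_mult)
      (auto intro!: continuous_intros simp: distrib_left simp flip: cis_mult)
  then have "\<i> * of_int (m + n) * fourier_coeff (\<lambda>x. cis (of_int m * x)) n = 0"
    unfolding fourier_coeff_cmult by (simp add: algebra_simps)
  moreover have "fourier_coeff (\<lambda>x. cis (of_int m * x)) n = 2 * pi" if "m + n = 0"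
    using that unfolding fourier_coeff_def
    by (simp add: cis_mult scaleR_conv_of_real flip: distrib_right of_int_add)
  ultimately show ?thesis
    by (auto simp flip: of_int_add)
qed

section \<open>Uniqueness: a continuous periodic function is determined by its Fourier
  coefficients\<close>

lemma continuous_on_real_polynomial_cis:
  assumes "real_polynomial_function p"
  shows "continuous_on S (\<lambda>x. p (cis x))"
proof -
  have "continuous_on UNIV p"
    using assms by (simp add: continuous_on_polymonial_function real_polynomial_function_eq)
  then show ?thesis
    by (rule continuous_on_compose2) (auto intro: continuous_intros)
qed

text \<open>A linear map of \<open>cis x\<close> is a combination of \<open>cis x\<close> and \<open>cis (- x)\<close>, and multiplying by these only
  shifts the index; hence vanishing of all coefficients is stable under multiplication by polynomials.\<close>

lemma fourier_coeff_mult_polynomial: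
  fixes p :: "complex \<Rightarrow> real"
  assumes "real_polynomial_function p" "continuous_on UNIV h" "\<And>n. fourier_coeff h n = 0"
  shows "fourier_coeff (\<lambda>x. h x * of_real (p (cis x))) n = 0"
  using assms
proof (induction arbitrary: h n rule: real_polynomial_function.induct)
  case (linear f)
  interpret bounded_linear f by fact
  define a where "a = (of_real (f 1) - \<i> * of_real (f \<i>)) / 2"
  define b where "b = (of_real (f 1) + \<i> * of_real (f \<i>)) / 2"
  have "f (cis x) = cos x * f 1 + sin x * f \<i>" for x
  proof -
    have "cis x = cos x *\<^sub>R 1 + sin x *\<^sub>R \<i>"
      by (simp add: complex_eq_iff)
    then show ?thesis
      by (metis add scaleR real_scaleR_def)
  qed
  then have "h x * of_real (f (cis x)) =
      a * (h x * cis (of_int 1 * x)) + b * (h x * cis (of_int (-1) * x))" for x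
    by (simp add: a_def b_def complex_eq_iff field_simps)
  moreover have "continuous_on UNIV (\<lambda>x. h x * cis (of_int k * x))" for k
    by (intro continuous_intros linear.prems)
  ultimately show ?case
    using linear.prems(2) by (simp only: fourier_coeff_add fourier_coeff_cmult fourier_coeff_mult_cis
      continuous_on_mult continuous_on_const) simp
next
  case (const c)
  then show ?case
    using fourier_coeff_cmult[of "of_real c" h] by (simp add: mult.commute)
next
  case (add f g)
  have "continuous_on UNIV (\<lambda>x. h x * of_real (f (cis x)))" "continuous_on UNIV (\<lambda>x. h x * of_real (g (cis x)))"
    by (intro continuous_intros add.prems continuous_on_real_polynomial_cis add.hyps)+
  with add show ?case
    by (simp add: distrib_left fourier_coeff_add)
next
  case (mult f g)
  \<comment> \<open>The hypothesis for g is applied to h times f, all of whose coefficients vanish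
    by the hypothesis for f; this is why h is arbitrary in the induction.\<close>
  have "continuous_on UNIV (\<lambda>x. h x * of_real (f (cis x)))"
    by (intro continuous_intros mult.prems continuous_on_real_polynomial_cis mult.hyps)
  with mult show ?case
    by (simp flip: mult.assoc)
qed

text \<open>The function g descends to F on the unit circle, where Stone-Weierstrass applies. Since
  \<open>Arg2pi\<close> jumps at 1, continuity of F is obtained from closed preimages: each one is
  the image under \<open>cis\<close> of a compact set.\<close>

lemma periodic_polynomial_approx:
  fixes g :: "real \<Rightarrow> real"
  assumes cont: "continuous_on UNIV g" and per: "\<And>x. g (x + 2 * pi) = g x" and "0 < e"
  obtains p :: "complex \<Rightarrow> real"
  where "real_polynomial_function p" "\<And>x. x \<in> {0..2*pi} \<Longrightarrow> \<bar>g x - p (cis x)\<bar> < e"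
proof -
  define F where "F z = g (Arg2pi z)" for z
  have F: "F (cis x) = g x" if "x \<in> {0..2*pi}" for x
  \<comment> \<open>\<open>Arg2pi\<close> takes values in [0, 2 pi), so at the right endpoint F
    returns g 0, which periodicity identifies with g (2 pi).\<close>
  proof (cases "x = 2 * pi")
    case True
    moreover have "Arg2pi 1 = 0"
      using Arg2pi_unique[of 1 0 1] by simp
    ultimately show ?thesis
      using per[of 0] by (simp add: F_def)
  next
    case False
    then have "Arg2pi (cis x) = x"
      using that by (intro Arg2pi_unique[of 1]) (auto simp: cis_conv_exp)
    then show ?thesis by (simp add: F_def)
  qed
  have range: "cis ` {0..2*pi} = sphere 0 1"
  proof -
    have "z \<in> cis ` {0..2*pi}" if "norm z = 1" for z
      using Arg2pi[of z] that by (intro image_eqI[of _ _ "Arg2pi z"]) (auto simp: cis_conv_exp is_Arg_def)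
    then show ?thesis by auto
  qed
  have "continuous_on (sphere 0 1) F"
    unfolding continuous_on_closed_vimage[OF closed_sphere]
  proof (intro allI impI)
    fix C :: "real set" assume C: "closed C"
    have "F -` C \<inter> sphere 0 1 = cis ` ({0..2*pi} \<inter> g -` C)"
      unfolding range[symmetric] using F by (auto simp: image_iff)
    moreover have "compact ({0..2*pi} \<inter> g -` C)"
      using C cont by (intro compact_Int_closed) (auto intro: closed_vimage)
    ultimately show "closed (F -` C \<inter> sphere 0 1)"
      by (auto intro!: compact_imp_closed compact_continuous_image continuous_intros)
  qed
  then obtain p where p: "real_polynomial_function p" "\<And>z. z \<in> sphere 0 1 \<Longrightarrow> \<bar>F z - p z\<bar> < e"
    using Stone_Weierstrass_real_polynomial_function[OF compact_sphere _ \<open>0 < e\<close>] by metis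
  have "\<bar>g x - p (cis x)\<bar> < e" if "x \<in> {0..2*pi}" for x
    using p(2)[of "cis x"] F[OF that] by simp
  with p(1) show thesis by (rule that)
qed

text \<open>g is orthogonal to every polynomial p in \<open>cis x\<close>, so the integral of g^2
  equals that of g (g - p). With p within e of g and g bounded by M this is at most 2 pi M e for
  every e > 0, hence g^2 has integral 0.\<close>

lemma fourier_coeff_zero_imp_zero:
  fixes g :: "real \<Rightarrow> real"
  assumes cont: "continuous_on UNIV g" and per: "\<And>x. g (x + 2 * pi) = g x"
    and zero: "\<And>n. fourier_coeff (\<lambda>x. of_real (g x)) n = 0"
  shows "g x = 0"
proof -
  have contI: "continuous_on {0..2*pi} g"
    using cont continuous_on_subset by blast
  obtain M where "0 < M" "\<forall>y\<in>g ` {0..2*pi}. \<bar>y\<bar> \<le> M"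
    using compact_imp_bounded[OF compact_continuous_image[OF contI compact_Icc]]
    unfolding bounded_pos real_norm_def by blast
  then have M: "\<And>x. x \<in> {0..2*pi} \<Longrightarrow> \<bar>g x\<bar> \<le> M" "0 < M"
    by blast+
  have le: "integral {0..2*pi} (\<lambda>x. g x * g x) \<le> M * e * (2 * pi)" if e: "0 < e" for e
  proof -
    obtain p where p: "real_polynomial_function p" "\<And>x. x \<in> {0..2*pi} \<Longrightarrow> \<bar>g x - p (cis x)\<bar> < e"
      using periodic_polynomial_approx[OF cont per e] by blast
    have contp: "continuous_on S (\<lambda>x. p (cis x))" for S
      by (rule continuous_on_real_polynomial_cis[OF p(1)])
    have "fourier_coeff (\<lambda>x. of_real (g x) * of_real (p (cis x))) 0 = 0"
      by (intro fourier_coeff_mult_polynomial p zero continuous_intros cont)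
    moreover have "(\<lambda>x. g x * p (cis x)) integrable_on {0..2*pi}"
      by (intro integrable_continuous_real continuous_intros contI contp)
    then have "integral {0..2*pi} (\<lambda>x. complex_of_real (g x * p (cis x)))
        = complex_of_real (integral {0..2*pi} (\<lambda>x. g x * p (cis x)))"
      using integral_linear[OF _ bounded_linear_of_real] unfolding o_def by blast
    ultimately have "integral {0..2*pi} (\<lambda>x. g x * p (cis x)) = 0"
      by (simp add: fourier_coeff_def)
    then have "integral {0..2*pi} (\<lambda>x. g x * g x) = integral {0..2*pi} (\<lambda>x. g x * (g x - p (cis x)))"
      unfolding right_diff_distrib
      by (subst integral_diff) (auto intro!: integrable_continuous_real continuous_intros contI contp)
    also have "\<dots> \<le> norm \<dots>"
      by simp
    also have "\<dots> \<le> M * e * (2 * pi - 0)"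
    proof (rule integral_bound)
      fix t assume "t \<in> {0..2*pi}"
      then show "norm (g t * (g t - p (cis t))) \<le> M * e"
        using M(1)[of t] p(2)[of t] by (auto simp: abs_mult intro!: mult_mono)
    qed (auto intro!: continuous_intros contI contp)
    finally show ?thesis by simp
  qed
  have "integral {0..2*pi} (\<lambda>x. g x * g x) \<le> 0"
  proof (rule field_le_epsilon)
    fix e :: real assume "0 < e"
    then show "integral {0..2*pi} (\<lambda>x. g x * g x) \<le> 0 + e"
      using le[of "e / (M * (2 * pi))"] M(2) by simp
  qed
  moreover have "0 \<le> integral {0..2*pi} (\<lambda>x. g x * g x)"
    by (intro integral_nonneg integrable_continuous_real continuous_intros contI) auto
  ultimately have "\<forall>x\<in>{0..2*pi}. g x * g x = 0"
    by (subst integral_eq_0_iff[symmetric]) (auto intro!: continuous_intros contI)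
  moreover obtain s where "0 \<le> s" "s < 2 * pi" "\<And>t. g (t + x) = g (t + s)"
    using periodic_reduce[of g x] per by blast
  ultimately show ?thesis
    by (metis add_0 atLeastAtMost_iff less_eq_real_def mult_eq_0_iff)
qed

subsection \<open>First-order variation of a norm\<close>

text \<open>The squares of the norm N and of its linearisation L + \<epsilon> s differ by exactly
  \<epsilon>^2 (|q|^2 - s^2). Dividing by the sum N + (L + \<epsilon> s), which stays above L / 2
  near 0, gives the error bound.\<close>

lemma norm_perturbation_bigo:
  fixes p q :: "'a::real_inner"
  assumes "p \<noteq> 0"
  shows "(\<lambda>\<epsilon>. norm (p + \<epsilon> *\<^sub>R q) - (norm p + \<epsilon> * (p \<bullet> q / norm p))) \<in> O[at 0](\<lambda>\<epsilon>. \<epsilon>\<^sup>2)"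
proof -
  define L s where "L = norm p" and "s = p \<bullet> q / norm p"
  have L: "0 < L" using assms by (simp add: L_def)
  have "((\<lambda>\<epsilon>::real. L + \<epsilon> * s) \<longlongrightarrow> L + 0 * s) (at 0)"
    by (intro tendsto_intros)
  then have ev: "\<forall>\<^sub>F \<epsilon> in at 0. 0 < L / 2 \<and> L / 2 < L + \<epsilon> * s"
    using L by (intro eventually_conj order_tendstoD) auto
  show ?thesis
    unfolding s_def[symmetric] unfolding L_def[symmetric]
  proof (rule bigoI)
    show "\<forall>\<^sub>F \<epsilon> in at 0. norm (norm (p + \<epsilon> *\<^sub>R q) - (L + \<epsilon> * s))
        \<le> (\<bar>(norm q)\<^sup>2 - s\<^sup>2\<bar> / (L / 2)) * norm (\<epsilon>\<^sup>2)"
      using ev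
    proof eventually_elim
      case e: (elim \<epsilon>)
      define N where "N = norm (p + \<epsilon> *\<^sub>R q)"
      have "N\<^sup>2 = L\<^sup>2 + 2 * \<epsilon> * (p \<bullet> q) + \<epsilon>\<^sup>2 * (norm q)\<^sup>2"
        unfolding N_def L_def power2_norm_eq_inner
        by (simp add: inner_add_left inner_add_right inner_commute power2_eq_square algebra_simps)
      also have "p \<bullet> q = L * s"
        using L by (simp add: L_def s_def)
      finally have "(N - (L + \<epsilon> * s)) * (N + (L + \<epsilon> * s)) = \<epsilon>\<^sup>2 * ((norm q)\<^sup>2 - s\<^sup>2)"
        by (simp add: power2_eq_square algebra_simps)
      then have "\<bar>N - (L + \<epsilon> * s)\<bar> * \<bar>N + (L + \<epsilon> * s)\<bar> = \<epsilon>\<^sup>2 * \<bar>(norm q)\<^sup>2 - s\<^sup>2\<bar>"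
        by (metis abs_mult abs_power2)
      moreover have "L / 2 \<le> \<bar>N + (L + \<epsilon> * s)\<bar>"
        using e norm_ge_zero[of "p + \<epsilon> *\<^sub>R q"] unfolding N_def by linarith
      ultimately have "\<bar>N - (L + \<epsilon> * s)\<bar> * (L / 2) \<le> \<epsilon>\<^sup>2 * \<bar>(norm q)\<^sup>2 - s\<^sup>2\<bar>"
        by (metis abs_ge_zero mult_left_mono)
      then show "norm (norm (p + \<epsilon> *\<^sub>R q) - (L + \<epsilon> * s))
          \<le> (\<bar>(norm q)\<^sup>2 - s\<^sup>2\<bar> / (L / 2)) * norm (\<epsilon>\<^sup>2)"
        using L unfolding N_def[symmetric] by (simp add: field_simps)
    qed
  qed
qed

text \<open>Dividing by \<epsilon> leaves |k| \<le> C |\<epsilon>|, and \<epsilon> tends to 0. This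
  makes first-order coefficients modulo \<epsilon>^2 unique.\<close>

lemma linear_bigo_square_iff:
  fixes k :: real
  shows "(\<lambda>\<epsilon>. \<epsilon> * k) \<in> O[at 0](\<lambda>\<epsilon>. \<epsilon>\<^sup>2) \<longleftrightarrow> k = 0"
proof
  assume "(\<lambda>\<epsilon>. \<epsilon> * k) \<in> O[at 0](\<lambda>\<epsilon>. \<epsilon>\<^sup>2)"
  then obtain C where "\<forall>\<^sub>F \<epsilon> in at 0. norm (\<epsilon> * k) \<le> C * norm (\<epsilon>\<^sup>2)"
    by (elim landau_o.bigE)
  moreover have "\<forall>\<^sub>F \<epsilon>::real in at 0. \<epsilon> \<noteq> 0"
    by (simp add: eventually_at_filter)
  ultimately have "\<forall>\<^sub>F \<epsilon> in at 0. \<bar>k\<bar> \<le> C * \<bar>\<epsilon>\<bar>"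
  proof eventually_elim
    case (elim \<epsilon>)
    then have "\<bar>\<epsilon>\<bar> * \<bar>k\<bar> \<le> \<bar>\<epsilon>\<bar> * (C * \<bar>\<epsilon>\<bar>)"
      by (simp add: abs_mult power2_eq_square mult.left_commute)
    then show ?case
      by (rule mult_left_le_imp_le) (use elim(2) in simp)
  qed
  moreover have "((\<lambda>\<epsilon>::real. C * \<bar>\<epsilon>\<bar>) \<longlongrightarrow> C * \<bar>0\<bar>) (at 0)"
    by (intro tendsto_intros)
  ultimately have "\<bar>k\<bar> \<le> C * \<bar>0\<bar>"
    by (intro tendsto_lowerbound) auto
  then show "k = 0" by simp
qed simp

text \<open>The proposed expansion and the true one differ by a term linear in \<epsilon>, which has
  to vanish.\<close>

lemma norm_perturbation_bigo_iff:
  fixes p q :: "'a::real_inner"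
  assumes "p \<noteq> 0"
  shows "(\<lambda>\<epsilon>. norm (p + \<epsilon> *\<^sub>R q) - (norm p + \<epsilon> * k)) \<in> O[at 0](\<lambda>\<epsilon>. \<epsilon>\<^sup>2)
    \<longleftrightarrow> p \<bullet> q = k * norm p" (is "?lhs \<longleftrightarrow> _")
proof -
  have "?lhs \<longleftrightarrow> (\<lambda>\<epsilon>. \<epsilon> * (p \<bullet> q / norm p - k)) \<in> O[at 0](\<lambda>\<epsilon>. \<epsilon>\<^sup>2)" (is "_ \<longleftrightarrow> ?rhs")
  proof
    assume ?lhs
    from sum_in_bigo(2)[OF this norm_perturbation_bigo[OF assms, of q]]
    show ?rhs by (simp add: algebra_simps)
  next
    assume ?rhs
    from sum_in_bigo(1)[OF this norm_perturbation_bigo[OF assms, of q]]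
    show ?lhs by (simp add: algebra_simps)
  qed
  then show ?thesis
    unfolding linear_bigo_square_iff using assms by (simp add: field_simps)
qed

subsection \<open>Deformations of the circle in the moving frame\<close>

definition unit_tangent :: "real \<Rightarrow> real ^ 2" where
  "unit_tangent x = vector [- sin x, cos x]"

lemma inner_real2: "(u::real^2) \<bullet> w = u $ 1 * w $ 1 + u $ 2 * w $ 2"
  by (simp add: inner_vec_def sum_2)

lemma vec_eq_iff_2: "(u::'a^2) = w \<longleftrightarrow> u $ 1 = w $ 1 \<and> u $ 2 = w $ 2"
  by (simp add: vec_eq_iff forall_2)

lemma has_vector_derivative_vector_2:
  assumes "(f has_real_derivative f') (at x)" "(g has_real_derivative g') (at x)"
  shows "((\<lambda>x. vector [f x, g x] :: real^2) has_vector_derivative vector [f', g']) (at x)"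
proof -
  have v: "vector [a, b] = a *\<^sub>R axis 1 1 + b *\<^sub>R (axis 2 1 :: real^2)" for a b
    by (simp add: vec_eq_iff_2 axis_def)
  show ?thesis
    unfolding v using assms
    by (auto intro!: derivative_eq_intros simp: has_real_derivative_iff_has_vector_derivative[symmetric])
qed

lemma unit_circle_has_vector_derivative:
  "(unit_circle has_vector_derivative unit_tangent x) (at x)"
  unfolding unit_circle_def[abs_def] unit_tangent_def
  by (rule has_vector_derivative_vector_2) (auto intro!: derivative_eq_intros)

lemma unit_tangent_has_vector_derivative:
  "(unit_tangent has_vector_derivative - unit_circle x) (at x)"
proof -
  have "- unit_circle x = vector [- cos x, - sin x]"
    by (simp add: unit_circle_def vec_eq_iff_2)
  then show ?thesis
    unfolding unit_tangent_def[abs_def]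
    by (auto intro!: has_vector_derivative_vector_2 derivative_eq_intros)
qed

text \<open>The chord of the circle between x - w and x + w is 2 sin w times the tangent at x. As 0
  < \<rho> < 1 it is nonzero, so the norm can be expanded there, and the positive factor 2 sin w
  cancels.\<close>

lemma infinitesimal_bicycle_deformation_iff:
  assumes "0 < \<rho>" "\<rho> < 1"
  shows "infinitesimal_bicycle_deformation \<rho> v \<longleftrightarrow>
    smooth v \<and> (\<forall>x. v (x + 2 * pi) = v x) \<and>
    (\<forall>x. unit_tangent x \<bullet> vector_derivative v (at x) = 0) \<and>
    (\<exists>c. \<forall>x. unit_tangent x \<bullet> (v (x + pi * \<rho>) - v (x - pi * \<rho>)) = 2 * c)"
proof -
  define w where "w = pi * \<rho>"
  have sin_pos: "0 < sin w"
    unfolding w_def using assms by (intro sin_gt_zero) auto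
  have chord: "unit_circle (x + w) - unit_circle (x - w) = (2 * sin w) *\<^sub>R unit_tangent x" for x
    by (simp add: vec_eq_iff_2 unit_circle_def unit_tangent_def cos_add cos_diff sin_add sin_diff)
  have norm_tangent: "norm (unit_tangent x) = 1" for x
    by (simp add: norm_eq_1 inner_real2 unit_tangent_def flip: power2_eq_square)
  have "(\<lambda>\<epsilon>. norm (perturbed_circle v \<epsilon> (x + w) - perturbed_circle v \<epsilon> (x - w))
          - 2 * (sin w + \<epsilon> * c)) \<in> O[at 0](\<lambda>\<epsilon>. \<epsilon>\<^sup>2)
    \<longleftrightarrow> unit_tangent x \<bullet> (v (x + w) - v (x - w)) = 2 * c" (is "?lhs \<longleftrightarrow> _") for x c
  proof -
    define p where "p = (2 * sin w) *\<^sub>R unit_tangent x"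
    have np: "norm p = 2 * sin w" and "p \<noteq> 0"
      using sin_pos norm_tangent[of x] by (auto simp: p_def)
    have "perturbed_circle v \<epsilon> (x + w) - perturbed_circle v \<epsilon> (x - w)
        = p + \<epsilon> *\<^sub>R (v (x + w) - v (x - w))" for \<epsilon>
      unfolding p_def chord[symmetric] perturbed_circle_def by (simp add: algebra_simps)
    then have "?lhs \<longleftrightarrow>
        (\<lambda>\<epsilon>. norm (p + \<epsilon> *\<^sub>R (v (x + w) - v (x - w))) - (norm p + \<epsilon> * (2 * c))) \<in> O[at 0](\<lambda>\<epsilon>. \<epsilon>\<^sup>2)"
      by (simp add: np distrib_left mult.left_commute)
    also have "\<dots> \<longleftrightarrow> p \<bullet> (v (x + w) - v (x - w)) = 2 * c * norm p"
      by (rule norm_perturbation_bigo_iff) fact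
    also have "\<dots> \<longleftrightarrow> unit_tangent x \<bullet> (v (x + w) - v (x - w)) = 2 * c"
      unfolding np using sin_pos by (simp add: p_def)
    finally show ?thesis .
  qed
  then show ?thesis
    unfolding infinitesimal_bicycle_deformation_def w_def[symmetric] Let_def
    by (simp add: vector_derivative_at[OF unit_circle_has_vector_derivative])
qed

lemma trivial_deformation_iff:
  "trivial_deformation v \<longleftrightarrow> (\<exists>a \<theta>. \<forall>x. v x = a + \<theta> *\<^sub>R unit_tangent x)"
proof -
  have t: "vector [- (unit_circle x $ 2), unit_circle x $ 1] = unit_tangent x" for x
    by (simp add: unit_circle_def unit_tangent_def)
  show ?thesis
    unfolding trivial_deformation_def infinitesimal_isometry_def
  proof safe
    fix X a \<theta> assume "\<forall>x. v x = X (unit_circle x)" "\<forall>p. X p = a + \<theta> *\<^sub>R vector [- (p $ 2), p $ 1]"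
    then show "\<exists>a \<theta>. \<forall>x. v x = a + \<theta> *\<^sub>R unit_tangent x"
      using t by auto
  next
    fix a \<theta> assume "\<forall>x. v x = a + \<theta> *\<^sub>R unit_tangent x"
    then show "\<exists>X. (\<exists>a \<theta>. \<forall>p. X p = a + \<theta> *\<^sub>R vector [- (p $ 2), p $ 1]) \<and> (\<forall>x. v x = X (unit_circle x))"
      by (intro exI[of _ "\<lambda>p. a + \<theta> *\<^sub>R vector [- (p $ 2), p $ 1]"]) (auto simp: t)
  qed
qed

section \<open>The linear difference-differential equation for the tangential component\<close>

text \<open>Non-resonance kills the coefficients of index at least 2; since b is real, conjugation
  kills those of index at most -2. A trigonometric polynomial of degree 1 matches the remaining
  three, and uniqueness identifies it with b.\<close>

lemma chord_equation_solutions: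
  fixes b b' :: "real \<Rightarrow> real"
  assumes der: "\<And>x. (b has_real_derivative b' x) (at x)"
    and cont: "continuous_on UNIV b'" and per: "\<And>x. b (x + 2 * pi) = b x" "\<And>x. b' (x + 2 * pi) = b' x"
    and eq: "\<And>x. sin w * (b' (x + w) + b' (x - w)) - cos w * (b (x + w) - b (x - w)) = k"
    and nores: "\<And>n::int. n \<ge> 2 \<Longrightarrow> of_int n * cos (of_int n * w) * sin w \<noteq> cos w * sin (of_int n * w)"
  obtains \<alpha> \<beta> \<gamma> where "\<And>x. b x = \<alpha> + \<beta> * cos x + \<gamma> * sin x"
proof -
  define f where "f x = complex_of_real (b x)" for x
  define f' where "f' x = complex_of_real (b' x)" for x
  have contb: "continuous_on UNIV b"
    using der DERIV_isCont continuous_at_imp_continuous_on by blast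
  have contf: "continuous_on UNIV f" "continuous_on UNIV f'"
    unfolding f_def f'_def by (intro continuous_intros contb cont)+
  have contfs: "continuous_on UNIV (\<lambda>x. f (x + s))" "continuous_on UNIV (\<lambda>x. f' (x + s))" for s
    by (auto intro!: continuous_intros continuous_on_compose2[OF contf(1)] continuous_on_compose2[OF contf(2)])
  have perf: "f (x + 2 * pi) = f x" "f' (x + 2 * pi) = f' x" for x
    by (simp_all add: f_def f'_def per)
  have derf: "(f has_vector_derivative f' x) (at x)" for x
    unfolding f_def f'_def by (rule has_vector_derivative_of_real[OF der])
  define B where "B = fourier_coeff f"
  have B_cnj: "B (- n) = cnj (B n)" for n
    using fourier_coeff_cnj[of f "- n"] by (simp add: B_def f_def[abs_def])
  have B_zero: "B n = 0" if n: "n \<ge> 2" for n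
  proof -
    \<comment> \<open>Coefficients of both sides of \<open>eq\<close>. Writing x + - w makes the
      shift rule applicable, and k is put as a multiple of \<open>cis (0 * x)\<close>, which
      contributes at index 0 only.\<close>
    have "fourier_coeff (\<lambda>x. of_real (sin w) * (f' (x + w) + f' (x + - w))
          - of_real (cos w) * (f (x + w) - f (x + - w))) n
       = fourier_coeff (\<lambda>x. of_real k * cis (of_int 0 * x)) n"
      using eq by (intro arg_cong2[where f = fourier_coeff] ext refl)
        (simp add: f_def f'_def flip: of_real_add of_real_diff of_real_mult)
    also have "\<dots> = 0"
      unfolding fourier_coeff_cmult fourier_coeff_cis using n by simp
    finally have "of_real (sin w) * (fourier_coeff (\<lambda>x. f' (x + w)) n + fourier_coeff (\<lambda>x. f' (x + - w)) n)
      - of_real (cos w) * (fourier_coeff (\<lambda>x. f (x + w)) n - fourier_coeff (\<lambda>x. f (x + - w)) n) = 0"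
      by (simp only: fourier_coeff_add fourier_coeff_diff fourier_coeff_cmult contfs
          continuous_on_add continuous_on_diff continuous_on_mult continuous_on_const)
    then have *: "of_real (sin w) * (- (\<i> * of_int n * B n) * (cis (of_int n * w) + cis (- (of_int n * w))))
      + of_real (cos w) * B n * (cis (of_int n * w) - cis (- (of_int n * w))) = 0"
      unfolding fourier_coeff_shift[OF contf(1) perf(1)] fourier_coeff_shift[OF contf(2) perf(2)]
        fourier_coeff_deriv[OF derf contf(2) perf(1)] B_def[symmetric]
      by (simp add: algebra_simps)
    have cs: "cis (of_int n * w) + cis (- (of_int n * w)) = 2 * of_real (cos (of_int n * w))"
      "cis (of_int n * w) - cis (- (of_int n * w)) = 2 * \<i> * of_real (sin (of_int n * w))"
      by (auto simp: complex_eq_iff)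
    from *[unfolded cs] have "- 2 * \<i> * B n *
        of_real (of_int n * cos (of_int n * w) * sin w - cos w * sin (of_int n * w)) = 0"
      by (simp add: algebra_simps)
    then have "B n = 0 \<or> of_int n * cos (of_int n * w) * sin w - cos w * sin (of_int n * w) = 0"
      by (simp only: mult_eq_0_iff of_real_eq_0_iff) simp
    then show ?thesis
      using nores[OF n] by simp
  qed
  \<comment> \<open>The function \<alpha> + \<beta> cos x + \<gamma> sin x has coefficients 2 pi
    \<alpha> at index 0 and pi (\<beta> + \<i> \<gamma>) at index 1; solve for the three
    constants.\<close>
  define \<alpha> \<beta> \<gamma> where "\<alpha> = Re (B 0) / (2 * pi)" and "\<beta> = Re (B 1) / pi" and "\<gamma> = Im (B 1) / pi"
  define g where "g x = b x - (\<alpha> + \<beta> * cos x + \<gamma> * sin x)" for x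
  have "g x = 0" for x
  proof (rule fourier_coeff_zero_imp_zero[of g])
    show "continuous_on UNIV g"
      unfolding g_def by (intro continuous_intros contb)
    show "g (x + 2 * pi) = g x" for x
      by (simp add: g_def per)
    fix n
    \<comment> \<open>A is the factor of \<open>cis x\<close> in \<beta> cos x + \<gamma> sin x, and
      its conjugate that of \<open>cis (- x)\<close>. By the kernel convention A is seen at index
      -1, so 2 pi A is the conjugate of B 1.\<close>
    define A where "A = Complex (\<beta> / 2) (- \<gamma> / 2)"
    have A: "2 * pi * A = cnj (B 1)" "2 * pi * cnj A = B 1"
      by (simp_all add: A_def \<beta>_def \<gamma>_def complex_eq_iff)
    have cis_cont: "continuous_on UNIV (\<lambda>x. cis (of_int k * x))" for k
      by (intro continuous_intros)
    have g: "of_real (g x) = f x - (of_real \<alpha> * cis (of_int 0 * x)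
        + (A * cis (of_int 1 * x) + cnj A * cis (of_int (-1) * x)))" for x
      by (simp add: g_def f_def A_def complex_eq_iff)
    have "fourier_coeff (\<lambda>x. of_real (g x)) n =
        B n - (of_real \<alpha> * fourier_coeff (\<lambda>x. cis (of_int 0 * x)) n
       + (A * fourier_coeff (\<lambda>x. cis (of_int 1 * x)) n + cnj A * fourier_coeff (\<lambda>x. cis (of_int (-1) * x)) n))"
      unfolding g B_def
      by (simp only: fourier_coeff_diff fourier_coeff_add fourier_coeff_cmult contf cis_cont
          continuous_on_add continuous_on_mult continuous_on_const)
    also have "\<dots> = 0"
    proof -
      consider "n = 0" | "n = 1" | "n = -1" | "n \<ge> 2" | "- n \<ge> 2"
        by linarith
      then show ?thesis
      proof cases
        case 1
        have "Im (B 0) = 0"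
          using B_cnj[of 0] by (simp add: complex_eq_iff)
        then have "2 * pi * of_real \<alpha> = B 0"
          by (simp add: \<alpha>_def complex_eq_iff)
        with 1 show ?thesis
          by (simp only: fourier_coeff_cis) (simp add: mult_ac)
      next
        case 5
        then show ?thesis
          using B_zero[OF 5] B_cnj[of n] by (simp only: fourier_coeff_cis) simp
      qed (use B_cnj[of 1] B_zero A in
          \<open>(simp only: fourier_coeff_cis, simp add: mult_ac)+\<close>)
    qed
    finally show "fourier_coeff (\<lambda>x. of_real (g x)) n = 0" .
  qed
  then show thesis
    by (intro that[of \<alpha> \<beta> \<gamma>]) (simp add: g_def)
qed

section \<open>Frame components of a deformation, and rigidity without resonance\<close>

lemma frame_inner [simp]:
  "unit_circle x \<bullet> unit_circle x = 1" "unit_tangent x \<bullet> unit_tangent x = 1"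
  "unit_circle x \<bullet> unit_tangent x = 0" "unit_tangent x \<bullet> unit_circle x = 0"
  by (simp_all add: inner_real2 unit_circle_def unit_tangent_def flip: power2_eq_square)

lemma frame_expansion:
  "v = (unit_circle x \<bullet> v) *\<^sub>R unit_circle x + (unit_tangent x \<bullet> v) *\<^sub>R unit_tangent x"
proof -
  have *: "cos x * (cos x * a) + sin x * (sin x * a) = a" for a
    by (simp flip: mult.assoc distrib_right power2_eq_square)
  show ?thesis
    unfolding vec_eq_iff_2 inner_real2 unit_circle_def unit_tangent_def
    using *[of "v $ 1"] *[of "v $ 2"] by (simp add: algebra_simps)
qed

lemma unit_tangent_rotate:
  "unit_tangent x = sin s *\<^sub>R unit_circle (x + s) + cos s *\<^sub>R unit_tangent (x + s)"
  using sin_diff[of s "x + s"] cos_diff[of s "x + s"]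
  by (simp add: vec_eq_iff_2 unit_circle_def unit_tangent_def)

text \<open>Expanding the tangent at the midpoint x in the frames at the two endpoints, by
  \<open>unit_tangent_rotate\<close> with angles w and -w, leaves only the frame components of v at
  those endpoints.\<close>

lemma chord_inner:
  "unit_tangent x \<bullet> (v (x + w) - v (x - w)) =
    sin w * (unit_circle (x + w) \<bullet> v (x + w) + unit_circle (x - w) \<bullet> v (x - w)) +
    cos w * (unit_tangent (x + w) \<bullet> v (x + w) - unit_tangent (x - w) \<bullet> v (x - w))"
proof -
  have "unit_tangent x \<bullet> v (x + w) =
      sin w * (unit_circle (x + w) \<bullet> v (x + w)) + cos w * (unit_tangent (x + w) \<bullet> v (x + w))"
    by (subst unit_tangent_rotate[of x w]) (simp add: inner_add_left)
  moreover have "unit_tangent x \<bullet> v (x - w) =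
      - sin w * (unit_circle (x - w) \<bullet> v (x - w)) + cos w * (unit_tangent (x - w) \<bullet> v (x - w))"
    by (subst unit_tangent_rotate[of x "- w"]) (simp add: inner_diff_left)
  ultimately show ?thesis
    by (simp add: inner_diff_right algebra_simps)
qed

lemma frame_periodic:
  "unit_circle (x + 2 * pi) = unit_circle x" "unit_tangent (x + 2 * pi) = unit_tangent x"
  by (simp_all add: unit_circle_def unit_tangent_def)

lemma deformation_trivial:
  assumes \<rho>: "0 < \<rho>" "\<rho> < 1" and v: "infinitesimal_bicycle_deformation \<rho> v"
    and nores: "\<And>n::int. n \<ge> 2 \<Longrightarrow> of_int n * cos (of_int n * (pi * \<rho>)) * sin (pi * \<rho>)
      \<noteq> cos (pi * \<rho>) * sin (of_int n * (pi * \<rho>))"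
  shows "trivial_deformation v"
proof -
  define a b where "a x = unit_circle x \<bullet> v x" and "b x = unit_tangent x \<bullet> v x" for x
  obtain c where smooth: "smooth v" and per: "\<And>x. v (x + 2 * pi) = v x"
    and arc: "\<And>x. unit_tangent x \<bullet> vector_derivative v (at x) = 0"
    and c: "\<And>x. unit_tangent x \<bullet> (v (x + pi * \<rho>) - v (x - pi * \<rho>)) = 2 * c"
    using v unfolding infinitesimal_bicycle_deformation_iff[OF \<rho>] by blast
  have "v differentiable (at x)" for x
    using smooth[unfolded smooth_def, rule_format, of 0 x] by simp
  then have dv: "(v has_vector_derivative vector_derivative v (at x)) (at x)" for x
    by (simp add: vector_derivative_works)
  \<comment> \<open>Product rule: the derivative of the tangent is minus the radial vector, and the
    term with v' vanishes by the arc length condition.\<close>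
  have der: "(b has_real_derivative - a x) (at x)" for x
    unfolding b_def[abs_def] has_real_derivative_iff_has_vector_derivative
    using bounded_bilinear.has_vector_derivative[OF bounded_bilinear_inner
        unit_tangent_has_vector_derivative dv, of x]
    by (simp add: arc a_def)
  have cont: "continuous_on UNIV (\<lambda>x. - a x)"
    unfolding a_def
    by (intro continuous_intros continuous_at_imp_continuous_on ballI
        has_vector_derivative_continuous[OF dv]
        has_vector_derivative_continuous[OF unit_circle_has_vector_derivative])
  \<comment> \<open>With b' = - a this is the negated chord condition, hence the constant -2
    c.\<close>
  have "sin (pi * \<rho>) * (- a (x + pi * \<rho>) + - a (x - pi * \<rho>))
      - cos (pi * \<rho>) * (b (x + pi * \<rho>) - b (x - pi * \<rho>)) = - (2 * c)" for x
    using c[of x] unfolding chord_inner a_def b_def by (simp add: algebra_simps)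
  then obtain \<alpha> \<beta> \<gamma> where b: "\<And>x. b x = \<alpha> + \<beta> * cos x + \<gamma> * sin x"
    using chord_equation_solutions[OF der cont _ _ _ nores]
    by (metis a_def b_def frame_periodic per)
  have "(b has_real_derivative - \<beta> * sin x + \<gamma> * cos x) (at x)" for x
    unfolding b[abs_def] by (auto intro!: derivative_eq_intros)
  then have a: "a x = \<beta> * sin x - \<gamma> * cos x" for x
    using DERIV_unique[OF der[of x]] by fastforce
  have sc: "sin x * sin x = 1 - cos x * cos x" for x :: real
    using sin_cos_squared_add[of x] by (simp add: power2_eq_square)
  \<comment> \<open>The modes \<beta> and \<gamma> recombine into the translation by (-\<gamma>,
    \<beta>), and the constant mode \<alpha> is the rotation.\<close>
  have "v x = vector [- \<gamma>, \<beta>] + \<alpha> *\<^sub>R unit_tangent x" for x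
  proof -
    have "v x = a x *\<^sub>R unit_circle x + b x *\<^sub>R unit_tangent x"
      unfolding a_def b_def by (rule frame_expansion)
    also have "\<dots> = vector [- \<gamma>, \<beta>] + \<alpha> *\<^sub>R unit_tangent x"
      unfolding a b by (simp add: vec_eq_iff_2 unit_circle_def unit_tangent_def sc algebra_simps)
    finally show ?thesis .
  qed
  then show ?thesis
    unfolding trivial_deformation_iff by blast
qed

section \<open>Construction of a non-trivial deformation at a resonance\<close>

text \<open>For fixed p and q this family is closed under differentiation, so every iterated
  derivative stays in it. Two frequencies suffice for a mode m in the moving frame, which has
  frequencies m - 1 and m + 1 in fixed coordinates.\<close>

lemma smooth_trig_sum:
  "smooth (\<lambda>x. cos (p * x) *\<^sub>R u\<^sub>1 + sin (p * x) *\<^sub>R u\<^sub>2 + cos (q * x) *\<^sub>R u\<^sub>3 + sin (q * x) *\<^sub>R u\<^sub>4)"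
proof -
  define T where "T u\<^sub>1 u\<^sub>2 u\<^sub>3 u\<^sub>4 =
      (\<lambda>x. cos (p * x) *\<^sub>R u\<^sub>1 + sin (p * x) *\<^sub>R u\<^sub>2 + cos (q * x) *\<^sub>R u\<^sub>3 + sin (q * x) *\<^sub>R u\<^sub>4)"
    for u\<^sub>1 u\<^sub>2 u\<^sub>3 u\<^sub>4 :: "real ^ 2"
  have T: "(T u\<^sub>1 u\<^sub>2 u\<^sub>3 u\<^sub>4
      has_vector_derivative T (p *\<^sub>R u\<^sub>2) (- p *\<^sub>R u\<^sub>1) (q *\<^sub>R u\<^sub>4) (- q *\<^sub>R u\<^sub>3) x) (at x)"
    for u\<^sub>1 u\<^sub>2 u\<^sub>3 u\<^sub>4 x
    unfolding T_def by (auto intro!: derivative_eq_intros simp: algebra_simps)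
  have "\<exists>w\<^sub>1 w\<^sub>2 w\<^sub>3 w\<^sub>4. ((\<lambda>g t. vector_derivative g (at t)) ^^ k) (T u\<^sub>1 u\<^sub>2 u\<^sub>3 u\<^sub>4)
      = T w\<^sub>1 w\<^sub>2 w\<^sub>3 w\<^sub>4" for k
  proof (induction k)
    case 0
    show ?case by auto
  next
    case (Suc k)
    then show ?case
      using vector_derivative_at[OF T] by fastforce
  qed
  then have "((\<lambda>g t. vector_derivative g (at t)) ^^ k) (T u\<^sub>1 u\<^sub>2 u\<^sub>3 u\<^sub>4) differentiable (at x)" for k x
    by (metis T differentiableI_vector)
  then show ?thesis
    unfolding smooth_def T_def by blast
qed

lemma resonance_deformation:
  fixes n :: int
  assumes \<rho>: "0 < \<rho>" "\<rho> < 1" and n: "n \<ge> 2"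
    and res: "of_int n * cos (of_int n * (pi * \<rho>)) * sin (pi * \<rho>)
      = cos (pi * \<rho>) * sin (of_int n * (pi * \<rho>))"
  shows "\<exists>v. infinitesimal_bicycle_deformation \<rho> v \<and> \<not> trivial_deformation v"
proof -
  define m where "m = real_of_int n"
  define w where "w = pi * \<rho>"
  have m: "m \<ge> 2" using n by (simp add: m_def)
  \<comment> \<open>Tangential part b = cos (m x); the arc length condition then dictates the radial
    part - b' = m sin (m x).\<close>
  define v where "v x = (m * sin (m * x)) *\<^sub>R unit_circle x + cos (m * x) *\<^sub>R unit_tangent x" for x
  have comp: "unit_circle x \<bullet> v x = m * sin (m * x)" "unit_tangent x \<bullet> v x = cos (m * x)" for x
    by (simp_all add: v_def inner_add_right)
  have "v = (\<lambda>x. cos ((m - 1) * x) *\<^sub>R vector [0, (m + 1) / 2]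
      + sin ((m - 1) * x) *\<^sub>R vector [(m + 1) / 2, 0]
      + cos ((m + 1) * x) *\<^sub>R vector [0, - (m - 1) / 2]
      + sin ((m + 1) * x) *\<^sub>R vector [(m - 1) / 2, 0])"
    by (rule ext) (simp add: v_def vec_eq_iff_2 unit_circle_def unit_tangent_def
        left_diff_distrib distrib_right cos_add cos_diff sin_add sin_diff field_simps)
  then have "smooth v"
    by (simp only: smooth_trig_sum)
  moreover have "v (x + 2 * pi) = v x" for x
  proof -
    have "cos (m * (2 * pi)) = 1" "sin (m * (2 * pi)) = 0"
      using cis_of_int_mult_2pi[of n] by (simp_all add: m_def complex_eq_iff)
    then show ?thesis
      by (simp add: v_def frame_periodic distrib_left sin_add cos_add)
  qed
  moreover have "unit_tangent x \<bullet> vector_derivative v (at x) = 0" for x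
  proof -
    \<comment> \<open>The tangential terms m sin (m x) cancel, so v' is purely radial.\<close>
    have "(v has_vector_derivative ((m * m - 1) * cos (m * x)) *\<^sub>R unit_circle x) (at x)"
      unfolding v_def
      by (auto intro!: derivative_eq_intros unit_circle_has_vector_derivative
          unit_tangent_has_vector_derivative simp: algebra_simps)
    then show ?thesis
      by (simp add: vector_derivative_at)
  qed
  moreover have "unit_tangent x \<bullet> (v (x + w) - v (x - w)) = 2 * 0" for x
  proof -
    \<comment> \<open>The sum formulas split off the resonance factor, which is zero by
      \<open>res\<close>; so the chord length is stationary and c = 0.\<close>
    have "unit_tangent x \<bullet> (v (x + w) - v (x - w))
        = 2 * sin (m * x) * (m * cos (m * w) * sin w - cos w * sin (m * w))"
      unfolding chord_inner comp
      by (simp add: distrib_left right_diff_distrib sin_add sin_diff cos_add cos_diff)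
    then show ?thesis
      using res by (simp add: m_def w_def)
  qed
  ultimately have "infinitesimal_bicycle_deformation \<rho> v"
    unfolding infinitesimal_bicycle_deformation_iff[OF \<rho>] w_def by blast
  moreover have "\<not> trivial_deformation v"
  proof
    assume "trivial_deformation v"
    then obtain u \<theta> where u: "\<And>x. v x = u + \<theta> *\<^sub>R unit_tangent x"
      unfolding trivial_deformation_iff by blast
    \<comment> \<open>Taking radial components eliminates the rotation. Then x = 0 and x = pi / m,
      where the left side vanishes, force u = 0, while at x = pi / (2 m) the left side is m, a
      contradiction.\<close>
    have *: "m * sin (m * x) = cos x * u $ 1 + sin x * u $ 2" for x
      using comp(1)[of x] unfolding u by (simp add: inner_add_right) (simp add: inner_real2 unit_circle_def)
    have "u $ 1 = 0"
      using *[of 0] by simp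
    moreover have "u $ 2 = 0"
    proof -
      have "sin (pi / m) \<noteq> 0"
        using m by (intro less_imp_neq[THEN not_sym] sin_gt_zero) (auto simp: field_simps)
      then show ?thesis
        using *[of "pi / m"] m \<open>u $ 1 = 0\<close> by simp
    qed
    ultimately show False
      using *[of "pi / 2 / m"] m by simp
  qed
  ultimately show ?thesis by blast
qed

theorem theorem7:
  fixes \<rho> :: real
  assumes "0 < \<rho>" and "\<rho> < 1"
  shows "(\<exists>v. infinitesimal_bicycle_deformation \<rho> v \<and> \<not> trivial_deformation v) \<longleftrightarrow>
    (\<exists>n::int. n \<ge> 2 \<and>
       of_int n * cos (of_int n * pi * \<rho>) * sin (pi * \<rho>) = cos (pi * \<rho>) * sin (of_int n * pi * \<rho>))"
  \<comment> \<open>The forward direction is the contrapositive of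
    \<open>deformation_trivial\<close>; reassociation brings the arguments to the form n (pi \<rho>)
    of the two lemmas.\<close>
  using deformation_trivial[OF assms] resonance_deformation[OF assms]
  unfolding mult.assoc[of _ pi \<rho>] by blast

end
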